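(* There is no deterministic block-connected mapping $f$ that assigns to a static binary search tree $T$ a static B-tree $T_B = f(T)$ such that every walk of length $k$ in $T$ corresponds to a walk of length $o(k)$ in $T_B$. (In fact this fails already when $T$ is the perfectly balanced BST on $N = 2^i - 1$ keys.)
   Context: A static BST (resp. static B-tree with parameter $B$, i.e. nodes holding at most $B-1$ sorted keys with one more child than keys, in search-tree order) is one whose shape never changes. A walk is a sequence of moves of a single pointer that starts at the root and at each step moves to a neighboring node (parent or child), at unit cost per move; its length/cost is the number of moves (plus the initial placement at the root). A walk in $T_B$ corresponds to a walk in $T$ if it touches (visits the B-tree nodes containing) the same keys as the walk in $T$, in the same order. A mapping $f: T\to T_B$ places the keys of $T$ into the nodes of a B-tree $T_B$; it is block-connected if, for every node of $T_B$, the set of nodes of $T$ whose keys it stores forms a connected subtree of $T$. *)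

theory Defs
  imports Complex_Main "HOL-Library.Tree" "HOL-Library.Landau_Symbols"
begin

(* The keys of a BST are pairwise distinct, so its nodes are identified with their keys. *)

definition tree_child :: "'a tree \<Rightarrow> 'a \<Rightarrow> 'a \<Rightarrow> bool" where
  "tree_child T a b \<longleftrightarrow>
     (\<exists>l r. \<langle>l, a, r\<rangle> \<in> subtrees T \<and>
        (l \<noteq> \<langle>\<rangle> \<and> b = value l \<or> r \<noteq> \<langle>\<rangle> \<and> b = value r))"

definition tree_adj :: "'a tree \<Rightarrow> 'a \<Rightarrow> 'a \<Rightarrow> bool" where
  "tree_adj T a b \<longleftrightarrow> tree_child T a b \<or> tree_child T b a"

(* A walk is the list of visited nodes.  Its cost, the number of moves plus one for the
   initial placement at the root, is therefore the length of the list. *)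

definition tree_walk :: "'a tree \<Rightarrow> 'a list \<Rightarrow> bool" where
  "tree_walk T p \<longleftrightarrow>
     T \<noteq> \<langle>\<rangle> \<and> p \<noteq> [] \<and> hd p = value T \<and> successively (tree_adj T) p"

definition connected_in_tree :: "'a tree \<Rightarrow> 'a set \<Rightarrow> bool" where
  "connected_in_tree T S \<longleftrightarrow>
     (\<forall>a\<in>S. \<forall>b\<in>S. (\<lambda>x y. x \<in> S \<and> y \<in> S \<and> tree_adj T x y)\<^sup>*\<^sup>* a b)"

(* BLeaf stands for a missing child (and for the empty tree); it is not a node. *)

datatype (btree_keys: 'a) btree = BLeaf | BNode "'a list" "'a btree list"

fun is_btree :: "nat \<Rightarrow> 'a::linorder btree \<Rightarrow> bool" where
  "is_btree B BLeaf \<longleftrightarrow> True"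
| "is_btree B (BNode ks cs) \<longleftrightarrow>
     length ks \<le> B - 1 \<and> length cs = length ks + 1 \<and> sorted_wrt (<) ks \<and>
     (\<forall>i<length ks. (\<forall>x\<in>btree_keys (cs ! i). x < ks ! i) \<and>
                    (\<forall>x\<in>btree_keys (cs ! Suc i). ks ! i < x)) \<and>
     (\<forall>c\<in>set cs. is_btree B c)"

(* A node is addressed by the list of child indices leading to it from the root. *)

fun node_keys :: "'a btree \<Rightarrow> nat list \<Rightarrow> 'a set option" where
  "node_keys BLeaf v = None"
| "node_keys (BNode ks cs) [] = Some (set ks)"
| "node_keys (BNode ks cs) (i # v) = (if i < length cs then node_keys (cs ! i) v else None)"

definition btree_nodes :: "'a btree \<Rightarrow> nat list set" where
  "btree_nodes t = {v. node_keys t v \<noteq> None}"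

definition btree_adj :: "nat list \<Rightarrow> nat list \<Rightarrow> bool" where
  "btree_adj u v \<longleftrightarrow> (\<exists>i. v = u @ [i]) \<or> (\<exists>i. u = v @ [i])"

definition btree_walk :: "'a btree \<Rightarrow> nat list list \<Rightarrow> bool" where
  "btree_walk t q \<longleftrightarrow>
     q \<noteq> [] \<and> hd q = [] \<and> set q \<subseteq> btree_nodes t \<and> successively btree_adj q"

(* \<sigma> i is the time at which the B-tree walk touches the i-th key of the BST walk.  It need
   not be strictly increasing: one visit to a node can touch several consecutive keys.  The
   B-tree walk may pass through further nodes in between. *)

definition corresponds :: "'a btree \<Rightarrow> nat list list \<Rightarrow> 'a list \<Rightarrow> bool" where
  "corresponds t q p \<longleftrightarrow>
     (\<exists>\<sigma> :: nat \<Rightarrow> nat. mono_on {..<length p} \<sigma> \<and>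
        (\<forall>i<length p. \<sigma> i < length q \<and> p ! i \<in> the (node_keys t (q ! \<sigma> i))))"

(* f need only behave as a mapping on the class of trees under consideration.  That every key
   is stored in one node only follows from the search-tree order. *)

definition block_connected_mapping ::
    "nat \<Rightarrow> 'a::linorder tree set \<Rightarrow> ('a tree \<Rightarrow> 'a btree) \<Rightarrow> bool" where
  "block_connected_mapping B \<T> f \<longleftrightarrow>
     (\<forall>T\<in>\<T>. is_btree B (f T) \<and> btree_keys (f T) = set_tree T \<and>
        (\<forall>v\<in>btree_nodes (f T). connected_in_tree T (the (node_keys (f T) v))))"

definition walks_within ::
    "'a tree set \<Rightarrow> ('a tree \<Rightarrow> 'a btree) \<Rightarrow> (nat \<Rightarrow> real) \<Rightarrow> bool" where
  "walks_within \<T> f g \<longleftrightarrow>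
     (\<forall>T\<in>\<T>. \<forall>p. tree_walk T p \<longrightarrow>
        (\<exists>q. btree_walk (f T) q \<and> corresponds (f T) q p \<and> real (length q) \<le> g (length p)))"

definition bsts :: "'a::linorder tree set" where
  "bsts = {T. bst T}"

definition perfect_bsts :: "nat \<Rightarrow> 'a::linorder tree set" where
  "perfect_bsts i = {T. bst T \<and> Tree.complete T \<and> size T = 2 ^ i - 1}"

end

theory Submission
  imports Defs
begin

text \<open>
  A tree with at least \<open>B\<close> keys does not fit into one node of the B-tree, and a key is stored in
  only one node, so some edge \<open>a\<close> -- \<open>b\<close> of the tree is split between two nodes. A walk that goes
  from the root to \<open>a\<close> and then alternates between \<open>a\<close> and \<open>b\<close> forces the B-tree pointer to move
  at every step, so its cost is at least \<open>k - d\<close> for a constant \<open>d\<close>.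
\<close>

section \<open>Each key of a B-tree lies in exactly one node\<close>

lemma node_keys_subset_btree_keys: "node_keys t v = Some S \<Longrightarrow> S \<subseteq> btree_keys t"
proof (induction t v arbitrary: S rule: node_keys.induct)
  case (3 ks cs i v)
  then have i: "i < length cs" and "node_keys (cs ! i) v = Some S"
    by (auto split: if_splits)
  then have "S \<subseteq> btree_keys (cs ! i)"
    using "3.IH" by blast
  then show ?case
    using i by (fastforce dest: nth_mem)
qed auto

lemma btree_key_in_node: "x \<in> btree_keys t \<Longrightarrow> \<exists>v S. node_keys t v = Some S \<and> x \<in> S"
proof (induction t)
  case (BNode ks cs)
  show ?case
  proof (cases "x \<in> set ks")
    case True
    then have "node_keys (BNode ks cs) [] = Some (set ks) \<and> x \<in> set ks"
      by simp
    then show ?thesis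
      by blast
  next
    case False
    then obtain c where c: "c \<in> set cs" "x \<in> btree_keys c"
      using BNode.prems by auto
    then obtain v S where vS: "node_keys c v = Some S" "x \<in> S"
      using BNode.IH by blast
    obtain i where "i < length cs" "cs ! i = c"
      using c by (auto simp: in_set_conv_nth)
    then have "node_keys (BNode ks cs) (i # v) = Some S"
      using vS by simp
    then show ?thesis
      using vS by blast
  qed
qed simp

lemma finite_card_node_keys:
  "is_btree B t \<Longrightarrow> node_keys t v = Some S \<Longrightarrow> finite S \<and> card S \<le> B - 1"
proof (induction t v arbitrary: S rule: node_keys.induct)
  case (2 ks cs)
  then show ?case
    using card_length[of ks] by auto
next
  case (3 ks cs i v)
  then show ?case
    by (auto split: if_splits)
qed simp

text \<open>The separator \<open>ks ! (j - 1)\<close> just before child \<open>j\<close> has index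
  at least \<open>i\<close>, so it exceeds all keys of child \<open>i\<close> and lies below all
  keys of child \<open>j\<close>.\<close>

lemma btree_children_disjoint:
  assumes "is_btree B (BNode ks cs)" "i < j" "j < length cs"
  shows "btree_keys (cs ! i) \<inter> btree_keys (cs ! j) = {}"
proof -
  obtain m where m: "j = Suc m"
    using assms(2) by (cases j) auto
  have lt: "m < length ks" "i \<le> m"
    using assms m by auto
  have "ks ! i \<le> ks ! m"
    using assms(1) lt by (cases "i = m") (auto simp: sorted_wrt_iff_nth_less less_imp_le)
  moreover have "x < ks ! i" if "x \<in> btree_keys (cs ! i)" for x
    using assms(1) lt that by auto
  moreover have "ks ! m < x" if "x \<in> btree_keys (cs ! j)" for x
    using assms(1) lt m that by auto
  ultimately show ?thesis
    by (meson disjoint_iff less_asym less_le_trans)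
qed

text \<open>A key at index \<open>j\<close> cannot lie in child \<open>i\<close>: if
  \<open>i \<le> j\<close>, it is at least \<open>ks ! i\<close>, which bounds that child from
  above; otherwise it is at most \<open>ks ! (i - 1)\<close>, which bounds the child from
  below.\<close>

lemma btree_node_child_disjoint:
  assumes "is_btree B (BNode ks cs)" "i < length cs"
  shows "set ks \<inter> btree_keys (cs ! i) = {}"
proof -
  have "False" if x: "x \<in> set ks" "x \<in> btree_keys (cs ! i)" for x
  proof -
    obtain j where j: "j < length ks" "ks ! j = x"
      using x by (auto simp: in_set_conv_nth)
    show False
    proof (cases "i \<le> j")
      case True
      then have "x < ks ! i"
        using assms j x by auto
      moreover have "ks ! i \<le> ks ! j"
        using assms(1) True j by (cases "i = j") (auto simp: sorted_wrt_iff_nth_less less_imp_le)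
      ultimately show False
        using j by simp
    next
      case False
      then obtain m where m: "i = Suc m"
        by (cases i) auto
      then have "ks ! m < x"
        using assms x by auto
      moreover have "ks ! j \<le> ks ! m"
        using assms False j m
        by (cases "j = m") (auto simp: sorted_wrt_iff_nth_less less_imp_le)
      ultimately show False
        using j by simp
    qed
  qed
  then show ?thesis
    by blast
qed

text \<open>The two addresses are followed down together. They cannot branch apart, since sibling
  subtrees share no key, and neither can stop before the other, since a node shares no key with its
  child subtrees.\<close>

lemma node_of_key_unique:
  assumes "is_btree B t" "node_keys t u = Some S" "node_keys t v = Some S'" "x \<in> S" "x \<in> S'"
  shows "u = v"
  using assms
proof (induction t u arbitrary: S S' v rule: node_keys.induct)
  case (2 ks cs)
  show ?case
  proof (cases v)
    case (Cons i w)
    then have "i < length cs" "x \<in> btree_keys (cs ! i)"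
      using 2 node_keys_subset_btree_keys by (auto split: if_splits)
    then show ?thesis
      using btree_node_child_disjoint[OF "2.prems"(1)] 2 by auto
  qed simp
next
  case (3 ks cs i u)
  have i: "i < length cs" "node_keys (cs ! i) u = Some S"
    using "3.prems"(2) by (auto split: if_splits)
  then have xi: "x \<in> btree_keys (cs ! i)"
    using node_keys_subset_btree_keys "3.prems"(4) by blast
  show ?case
  proof (cases v)
    case Nil
    then show ?thesis
      using btree_node_child_disjoint[OF "3.prems"(1) i(1)] xi "3.prems"(3,5) by auto
  next
    case (Cons j w)
    then have j: "j < length cs" "node_keys (cs ! j) w = Some S'"
      using "3.prems"(3) by (auto split: if_splits)
    then have xj: "x \<in> btree_keys (cs ! j)"
      using node_keys_subset_btree_keys "3.prems"(5) by blast
    have "i = j"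
      using btree_children_disjoint[OF "3.prems"(1)] i(1) j(1) xi xj
      by (metis disjoint_iff linorder_neqE_nat)
    moreover have "is_btree B (cs ! i)"
      using "3.prems"(1) i(1) by auto
    ultimately show ?thesis
      using "3.IH"[OF i(1) _ i(2) _ "3.prems"(4,5)] j Cons by simp
  qed
qed simp

section \<open>Paths from the root of the search tree\<close>

lemma tree_child_mono: "tree_child T a b \<Longrightarrow> T \<in> subtrees T' \<Longrightarrow> tree_child T' a b"
proof (induction T')
  case (Node l x r)
  then show ?case
    by (cases "T = \<langle>l, x, r\<rangle>") (auto simp: tree_child_def)
qed (simp add: tree_child_def)

lemma tree_child_reachable: "x \<in> set_tree T \<Longrightarrow> (tree_child T)\<^sup>*\<^sup>* (value T) x"
proof (induction T)
  case (Node l y r)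
  let ?T = "\<langle>l, y, r\<rangle>"
  have "(tree_child ?T)\<^sup>*\<^sup>* y x" if c: "c = l \<or> c = r" "x \<in> set_tree c" for c
  proof -
    have "(tree_child c)\<^sup>*\<^sup>* (value c) x"
      using Node.IH c by blast
    moreover have "c \<in> subtrees ?T"
      using c by (cases l; cases r) auto
    ultimately have "(tree_child ?T)\<^sup>*\<^sup>* (value c) x"
      using tree_child_mono[of c _ _ ?T] by (metis mono_rtranclp)
    moreover have "c \<noteq> \<langle>\<rangle>"
      using c(2) by auto
    then have "tree_child ?T y (value c)"
      unfolding tree_child_def using c(1) by (intro exI[of _ l] exI[of _ r]) auto
    ultimately show ?thesis
      by (rule converse_rtranclp_into_rtranclp[rotated])
  qed
  then show ?case
    using Node.prems by auto
qed simp

text \<open>The endpoint is kept apart from \<open>p\<close> so that \<open>[b]\<close> can later be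
  replaced by any path that starts at \<open>b\<close>.\<close>

lemma rtranclp_successively:
  assumes "R\<^sup>*\<^sup>* a b"
  obtains p where "successively R (p @ [b])" "hd (p @ [b]) = a"
proof -
  from assms have "\<exists>p. successively R (p @ [b]) \<and> hd (p @ [b]) = a"
  proof induction
    case base
    have "successively R ([] @ [a]) \<and> hd ([] @ [a]) = a"
      by simp
    then show ?case
      by blast
  next
    case (step b c)
    then obtain p where "successively R (p @ [b])" "hd (p @ [b]) = a"
      by blast
    then have "successively R ((p @ [b]) @ [c]) \<and> hd ((p @ [b]) @ [c]) = a"
      using step.hyps by (auto simp: successively_append_iff hd_append split: if_splits)
    then show ?case
      by blast
  qed
  then show thesis
    using that by blast
qed

section \<open>An edge whose ends share no node\<close>

text \<open>If the ends of every edge reachable from the root shared a node, then uniqueness of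
  nodes would put all keys into the node of \<open>value T\<close>, which holds at most
  \<open>B - 1\<close> of them. Reachability of \<open>a\<close> is recorded because the walk must
  first get there.\<close>

lemma split_edge_exists:
  assumes "is_btree B t" "btree_keys t = set_tree T" "0 < B" "B \<le> card (set_tree T)"
  obtains (edge) a b where "(tree_child T)\<^sup>*\<^sup>* (value T) a" "tree_child T a b"
    "\<And>v. v \<in> btree_nodes t \<Longrightarrow> \<not> (a \<in> the (node_keys t v) \<and> b \<in> the (node_keys t v))"
proof (rule ccontr)
  assume no: "\<not> thesis"
  have together: "\<exists>v S. node_keys t v = Some S \<and> a \<in> S \<and> b \<in> S"
    if ab: "(tree_child T)\<^sup>*\<^sup>* (value T) a" "tree_child T a b" for a b
  proof (rule ccontr)
    assume none: "\<not> ?thesis"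
    have "\<not> (a \<in> the (node_keys t v) \<and> b \<in> the (node_keys t v))"
      if "v \<in> btree_nodes t" for v
      using none that by (auto simp: btree_nodes_def)
    then show False
      using no edge[OF ab] by blast
  qed
  have "set_tree T \<noteq> {}"
    using assms by auto
  then have "value T \<in> btree_keys t"
    using assms by (cases T) auto
  then obtain v S where v: "node_keys t v = Some S" "value T \<in> S"
    using btree_key_in_node by metis
  have "x \<in> S" if "(tree_child T)\<^sup>*\<^sup>* (value T) x" for x
    using that
  proof induction
    case (step y z)
    then obtain u S' where u: "node_keys t u = Some S'" "y \<in> S'" "z \<in> S'"
      using together by blast
    then have "u = v"
      using node_of_key_unique[OF assms(1) _ v(1)] step.IH by blast
    then show ?case
      using u v by simp
  qed (fact v(2))
  then have "set_tree T \<subseteq> S"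
    by (auto dest: tree_child_reachable)
  then have "card (set_tree T) \<le> B - 1"
    using finite_card_node_keys[OF assms(1) v(1)] by (meson card_mono order_trans)
  \<comment> \<open>Subtraction on naturals truncates, so \<open>0 < B\<close> is what makes
    \<open>B - 1\<close> smaller than \<open>B\<close>.\<close>
  then show False
    using assms by simp
qed

section \<open>The cost of alternating along the split edge\<close>

lemma successively_alternate:
  assumes "R a b" "R b a"
  shows "successively R (map (\<lambda>i. if even i then a else b) [0..<n])"
  using assms by (auto simp: successively_conv_nth)

text \<open>Consecutive keys of the alternating stretch share no node, so the touching times
  \<open>\<sigma>\<close> strictly increase there, which gives
  \<open>i \<le> \<sigma> (d + i)\<close>.\<close>

lemma corresponds_alternate_length:
  assumes q: "btree_walk t q" and c: "corresponds t q p"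
    and alt: "\<And>i. i < n \<Longrightarrow> p ! (d + i) = (if even i then a else b)"
    and len: "length p = d + n"
    and split: "\<And>v. v \<in> btree_nodes t \<Longrightarrow>
      \<not> (a \<in> the (node_keys t v) \<and> b \<in> the (node_keys t v))"
  shows "n \<le> length q"
proof -
  obtain \<sigma> where mono: "mono_on {..<length p} \<sigma>"
    and \<sigma>: "\<And>i. i < length p \<Longrightarrow> \<sigma> i < length q \<and> p ! i \<in> the (node_keys t (q ! \<sigma> i))"
    using c unfolding corresponds_def by blast
  have "i \<le> \<sigma> (d + i)" if "i < n" for i
    using that
  proof (induction i)
    case (Suc i)
    have "\<sigma> (d + i) \<le> \<sigma> (d + Suc i)"
      using Suc.prems len by (intro mono_onD[OF mono]) auto
    moreover have "\<sigma> (d + i) \<noteq> \<sigma> (d + Suc i)"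
    proof
      assume eq: "\<sigma> (d + i) = \<sigma> (d + Suc i)"
      let ?v = "q ! \<sigma> (d + i)"
      have "?v \<in> btree_nodes t"
        using q \<sigma>[of "d + i"] Suc.prems len unfolding btree_walk_def by auto
      moreover have "p ! (d + i) \<in> the (node_keys t ?v)"
        using \<sigma>[of "d + i"] Suc.prems len by simp
      moreover have "p ! (d + Suc i) \<in> the (node_keys t ?v)"
        using \<sigma>[of "d + Suc i"] eq Suc.prems len by simp
      ultimately show False
        using split[of ?v] alt[of i] alt[of "Suc i"] Suc.prems by (auto split: if_splits)
    qed
    ultimately show ?case
      using Suc by simp
  qed simp
  \<comment> \<open>The last alternating key is touched at a time that is at least
    \<open>n - 1\<close> and less than \<open>length q\<close>.\<close>
  then show ?thesis
    using \<sigma>[of "d + (n - 1)"] len by (cases n) force+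
qed

text \<open>Here \<open>d\<close> is the number of entries before the first \<open>a\<close> of the
  alternation; the other \<open>k - d\<close> entries of a walk of length \<open>k\<close> alternate
  between the ends of a split edge.\<close>

lemma walks_within_lower_bound:
  assumes "is_btree B (f T)" "btree_keys (f T) = set_tree T" "0 < B" "B \<le> card (set_tree T)"
    and within: "walks_within {T} f g"
  obtains d where "\<And>k. d < k \<Longrightarrow> real k - real d \<le> g k"
proof -
  obtain a b where ab: "(tree_child T)\<^sup>*\<^sup>* (value T) a" "tree_child T a b"
    and split: "\<And>v. v \<in> btree_nodes (f T) \<Longrightarrow>
      \<not> (a \<in> the (node_keys (f T) v) \<and> b \<in> the (node_keys (f T) v))"
    using split_edge_exists[OF assms(1-4)] by blast
  have "(tree_adj T)\<^sup>*\<^sup>* (value T) a"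
    using ab(1) by (rule rtranclp_mono[THEN predicate2D, rotated]) (auto simp: tree_adj_def)
  then obtain p where p: "successively (tree_adj T) (p @ [a])" "hd (p @ [a]) = value T"
    by (rule rtranclp_successively)
  have "real k - real (length p) \<le> g k" if k: "length p < k" for k
  proof -
    define n where "n = k - length p"
    have n: "0 < n" "length p + n = k"
      using k by (auto simp: n_def)
    define alt where "alt = map (\<lambda>i. if even i then a else b) [0..<n]"
    have alt: "alt \<noteq> []" "hd alt = a" "length alt = n"
      using n by (auto simp: alt_def hd_map)
    have "successively (tree_adj T) alt"
      unfolding alt_def using ab(2) by (intro successively_alternate) (auto simp: tree_adj_def)
    then have "successively (tree_adj T) (p @ alt)"
      using p(1) alt by (auto simp: successively_append_iff)
    \<comment> \<open>If \<open>p\<close> is empty, the walk starts with \<open>a\<close>, and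
      \<open>p(2)\<close> says that \<open>a\<close> is the root key.\<close>
    moreover have "hd (p @ alt) = value T"
      using p(2) alt by (cases p) auto
    moreover have "T \<noteq> \<langle>\<rangle>"
      using assms by auto
    ultimately have "tree_walk T (p @ alt)"
      using alt by (auto simp: tree_walk_def)
    then obtain q where q: "btree_walk (f T) q" "corresponds (f T) q (p @ alt)"
      "real (length q) \<le> g (length (p @ alt))"
      using within unfolding walks_within_def by blast
    have "n \<le> length q"
      by (rule corresponds_alternate_length[OF q(1,2) _ _ split])
        (auto simp: alt nth_append alt_def)
    moreover have "length (p @ alt) = k"
      using alt n by simp
    ultimately show ?thesis
      using q(3) n by simp
  qed
  then show thesis
    using that by blast
qed

text \<open>The lower bound \<open>k - d\<close> exceeds \<open>k / 2\<close> once
  \<open>k > 2 * d\<close>. The upper bound is assumed only as an eventual bound by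
  \<open>k / 2\<close>, a form that both little-o readings yield.\<close>

lemma not_sublinear_walks:
  assumes map: "block_connected_mapping B \<T> f" and "T \<in> \<T>" "bst T" "2 \<le> B" "B \<le> size T"
    and within: "walks_within \<T> f g"
    and half: "\<forall>\<^sub>F k in at_top. \<bar>g k\<bar> \<le> real k / 2"
  shows False
proof -
  have "card (set_tree T) = size T"
    using assms(3)
    by (metis bst_iff_sorted_wrt_less distinct_card length_inorder set_inorder strict_sorted_iff)
  then have "B \<le> card (set_tree T)"
    using assms by simp
  moreover have "is_btree B (f T)" "btree_keys (f T) = set_tree T"
    using map assms(2) by (auto simp: block_connected_mapping_def)
  moreover have "walks_within {T} f g"
    using within assms(2) by (auto simp: walks_within_def)
  ultimately obtain d where d: "\<And>k. d < k \<Longrightarrow> real k - real d \<le> g k"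
    using walks_within_lower_bound[of B f T g] assms(4) by auto
  have "\<forall>\<^sub>F k in at_top. 2 * d < k"
    by (rule eventually_gt_at_top)
  with half have "\<forall>\<^sub>F k :: nat in at_top. False"
  proof eventually_elim
    case (elim k)
    then have "real k - real d \<le> real k / 2" "2 * real d < real k"
      using d[of k] by auto
    then show ?case
      by simp
  qed
  then show False
    by simp
qed

section \<open>Large perfect search trees\<close>

text \<open>The median, at index \<open>2 ^ i - 1\<close>, becomes the root and leaves
  \<open>2 ^ i - 1\<close> entries on either side. The height is part of the claim because
  completeness requires both subtrees to be equally high.\<close>

lemma complete_tree_of_list:
  "length xs = 2 ^ i - 1 \<Longrightarrow> \<exists>T. inorder T = xs \<and> Tree.complete T \<and> height T = i"
proof (induction i arbitrary: xs)
  case 0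
  then have "inorder \<langle>\<rangle> = xs \<and> Tree.complete \<langle>\<rangle> \<and> height \<langle>\<rangle> = 0"
    by simp
  then show ?case
    by blast
next
  case (Suc i)
  let ?m = "2 ^ i - 1 :: nat"
  have len: "length xs = ?m + Suc ?m"
    using Suc.prems by (simp add: mult_2)
  then obtain l where l: "inorder l = take ?m xs" "Tree.complete l" "height l = i"
    using Suc.IH[of "take ?m xs"] by auto
  from len obtain r where r: "inorder r = drop (Suc ?m) xs" "Tree.complete r" "height r = i"
    using Suc.IH[of "drop (Suc ?m) xs"] by auto
  have "?m < length xs"
    using len by linarith
  then have "inorder \<langle>l, xs ! ?m, r\<rangle> = xs"
    using l r id_take_nth_drop[of ?m xs] by simp
  then have "inorder \<langle>l, xs ! ?m, r\<rangle> = xs \<and> Tree.complete \<langle>l, xs ! ?m, r\<rangle> \<and>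
      height \<langle>l, xs ! ?m, r\<rangle> = Suc i"
    using l r by simp
  then show ?case
    by blast
qed

lemma perfect_bst_exists:
  assumes "infinite (UNIV :: 'a::linorder set)"
  obtains T :: "'a::linorder tree" where "T \<in> perfect_bsts i"
proof -
  obtain A :: "'a set" where A: "finite A" "card A = 2 ^ i - 1"
    using infinite_arbitrarily_large[OF assms] by blast
  then have "length (sorted_list_of_set A) = 2 ^ i - 1"
    by simp
  then obtain T where T: "inorder T = sorted_list_of_set A" "Tree.complete T"
    using complete_tree_of_list by blast
  have "size T = 2 ^ i - 1"
    using T A by (metis length_inorder length_sorted_list_of_set)
  then have "T \<in> perfect_bsts i"
    using T by (simp add: perfect_bsts_def bst_iff_sorted_wrt_less)
  then show thesis
    by (rule that)
qed

lemma large_perfect_bst_exists: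
  assumes "infinite (UNIV :: 'a::linorder set)"
  obtains T :: "'a::linorder tree" where "T \<in> (\<Union>i. perfect_bsts i)" "bst T" "B \<le> size T"
proof -
  \<comment> \<open>Height \<open>B\<close> suffices because \<open>B < 2 ^ B\<close>.\<close>
  obtain T :: "'a tree" where "T \<in> perfect_bsts B"
    using perfect_bst_exists[OF assms] .
  moreover have "B \<le> 2 ^ B - 1"
    using less_exp[of B] by linarith
  ultimately show thesis
    using that[of T] unfolding perfect_bsts_def by auto
qed

section \<open>From little-o to a bound by half\<close>

lemma smallo_eventually_half:
  fixes g :: "nat \<Rightarrow> real"
  assumes "g \<in> o(\<lambda>k. real k)"
  shows "\<forall>\<^sub>F k in at_top. \<bar>g k\<bar> \<le> real k / 2"
  using landau_o.smallD[OF assms, of "1/2"] by simp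

text \<open>An event of the product filter contains a rectangle of large \<open>B\<close> and large
  \<open>k\<close>. Fixing one such \<open>B\<close>, which can also be taken at least 2, leaves a
  statement about \<open>k\<close> alone.\<close>

lemma smallo_prod_eventually_half:
  fixes g :: "nat \<Rightarrow> nat \<Rightarrow> real"
  assumes "(\<lambda>(B, k). g B k) \<in> o[at_top \<times>\<^sub>F at_top](\<lambda>(B, k). real k)"
  obtains B where "2 \<le> B" "\<forall>\<^sub>F k in at_top. \<bar>g B k\<bar> \<le> real k / 2"
proof -
  have "\<forall>\<^sub>F (B, k) in at_top \<times>\<^sub>F at_top. \<bar>g B k\<bar> \<le> real k / 2"
    using landau_o.smallD[OF assms, of "1/2"] by (simp add: case_prod_unfold)
  then obtain P Q where P: "eventually P at_top" and Q: "eventually Q at_top"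
    and PQ: "\<And>B k. P B \<Longrightarrow> Q k \<Longrightarrow> \<bar>g B k\<bar> \<le> real k / 2"
    unfolding eventually_prod_filter by auto
  have "\<forall>\<^sub>F B in at_top. P B \<and> 2 \<le> B"
    using P eventually_ge_at_top by (rule eventually_conj)
  then obtain B where "P B" "2 \<le> B"
    using eventually_happens[of _ "at_top :: nat filter"] by auto
  moreover have "\<forall>\<^sub>F k in at_top. \<bar>g B k\<bar> \<le> real k / 2"
    using Q by (rule eventually_mono) (rule PQ[OF \<open>P B\<close>])
  ultimately show thesis
    using that by blast
qed

text \<open>First \<open>B\<close> is fixed, then a perfect tree with at least \<open>B\<close> keys
  is chosen. The inclusion \<open>sup\<close> lets one argument serve all search trees as well as
  the perfect ones.\<close>

lemma not_sublinear_walks_prod: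
  fixes f :: "nat \<Rightarrow> 'a::linorder tree \<Rightarrow> 'a btree" and g
  assumes keys: "infinite (UNIV :: 'a set)" and sup: "(\<Union>i. perfect_bsts i) \<subseteq> \<T>"
    and map: "\<forall>B\<ge>2. block_connected_mapping B \<T> (f B)"
    and small: "(\<lambda>(B, k). g B k) \<in> o[at_top \<times>\<^sub>F at_top](\<lambda>(B, k). real k)"
    and within: "\<forall>B\<ge>2. walks_within \<T> (f B) (g B)"
  shows False
proof -
  obtain B where B: "2 \<le> B" "\<forall>\<^sub>F k in at_top. \<bar>g B k\<bar> \<le> real k / 2"
    using smallo_prod_eventually_half[OF small] .
  obtain T :: "'a tree" where T: "T \<in> (\<Union>i. perfect_bsts i)" "bst T" "B \<le> size T"
    using large_perfect_bst_exists[OF keys] .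
  show False
    using not_sublinear_walks[of B \<T> "f B" T "g B"] B T sup map within by blast
qed

text \<open>Little-o leaves open whether \<open>B\<close> is constant or grows too, so both readings
  are refuted, each for general and for perfect search trees. An infinite key type supplies trees
  with at least \<open>B\<close> keys.\<close>

theorem theorem3:
  assumes keys: "infinite (UNIV :: 'a::linorder set)"
  shows
    \<comment> \<open>fixed parameter \<open>B\<close>, \<open>k\<close> tending to infinity\<close>
    "(\<forall>B\<ge>2. \<not> (\<exists>(f :: 'a tree \<Rightarrow> 'a btree) g.
        block_connected_mapping B bsts f \<and>
        g \<in> o(\<lambda>k. real k) \<and> walks_within bsts f g)) \<and>
     (\<forall>B\<ge>2. \<forall>i. B \<le> 2 ^ i - 1 \<longrightarrow> (\<forall>T\<in>perfect_bsts i.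
      \<not> (\<exists>(f :: 'a tree \<Rightarrow> 'a btree) g.
        block_connected_mapping B {T} f \<and>
        g \<in> o(\<lambda>k. real k) \<and> walks_within {T} f g))) \<and>
     \<comment> \<open>\<open>B\<close> and \<open>k\<close> both tending to infinity\<close>
     \<not> (\<exists>(f :: nat \<Rightarrow> 'a tree \<Rightarrow> 'a btree) g.
        (\<forall>B\<ge>2. block_connected_mapping B bsts (f B)) \<and>
        (\<lambda>(B, k). g B k) \<in> o[at_top \<times>\<^sub>F at_top](\<lambda>(B, k). real k) \<and>
        (\<forall>B\<ge>2. walks_within bsts (f B) (g B))) \<and>
     \<not> (\<exists>(f :: nat \<Rightarrow> 'a tree \<Rightarrow> 'a btree) g.
        (\<forall>B\<ge>2. block_connected_mapping B (\<Union>i. perfect_bsts i) (f B)) \<and>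
        (\<lambda>(B, k). g B k) \<in> o[at_top \<times>\<^sub>F at_top](\<lambda>(B, k). real k) \<and>
        (\<forall>B\<ge>2. walks_within (\<Union>i. perfect_bsts i) (f B) (g B)))"
proof (intro conjI)
  have perfect_bsts: "(\<Union>i. perfect_bsts i) \<subseteq> (bsts :: 'a tree set)"
    by (auto simp: bsts_def perfect_bsts_def)
  show "\<forall>B\<ge>2. \<not> (\<exists>(f :: 'a tree \<Rightarrow> 'a btree) g.
      block_connected_mapping B bsts f \<and> g \<in> o(\<lambda>k. real k) \<and> walks_within bsts f g)"
  proof (intro allI impI notI; elim exE conjE)
    fix B :: nat and f :: "'a tree \<Rightarrow> 'a btree" and g
    assume *: "2 \<le> B" "block_connected_mapping B bsts f" "g \<in> o(\<lambda>k. real k)"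
      "walks_within bsts f g"
    obtain T :: "'a tree" where T: "bst T" "B \<le> size T"
      using large_perfect_bst_exists[OF keys] by metis
    show False
      using not_sublinear_walks[OF *(2) _ T(1) *(1) T(2) *(4) smallo_eventually_half[OF *(3)]] T(1)
      by (simp add: bsts_def)
  qed
  show "\<forall>B\<ge>2. \<forall>i. B \<le> 2 ^ i - 1 \<longrightarrow> (\<forall>T\<in>perfect_bsts i.
      \<not> (\<exists>(f :: 'a tree \<Rightarrow> 'a btree) g. block_connected_mapping B {T} f \<and>
        g \<in> o(\<lambda>k. real k) \<and> walks_within {T} f g))"
    \<comment> \<open>The class is \<open>{T}\<close> itself, and \<open>size T = 2 ^ i - 1\<close>
      gives \<open>B \<le> size T\<close>.\<close>
    using not_sublinear_walks smallo_eventually_half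
    by (fastforce simp: perfect_bsts_def)
  show "\<not> (\<exists>(f :: nat \<Rightarrow> 'a tree \<Rightarrow> 'a btree) g.
      (\<forall>B\<ge>2. block_connected_mapping B bsts (f B)) \<and>
      (\<lambda>(B, k). g B k) \<in> o[at_top \<times>\<^sub>F at_top](\<lambda>(B, k). real k) \<and>
      (\<forall>B\<ge>2. walks_within bsts (f B) (g B)))"
    using not_sublinear_walks_prod[OF keys perfect_bsts] by blast
  show "\<not> (\<exists>(f :: nat \<Rightarrow> 'a tree \<Rightarrow> 'a btree) g.
      (\<forall>B\<ge>2. block_connected_mapping B (\<Union>i. perfect_bsts i) (f B)) \<and>
      (\<lambda>(B, k). g B k) \<in> o[at_top \<times>\<^sub>F at_top](\<lambda>(B, k). real k) \<and>
      (\<forall>B\<ge>2. walks_within (\<Union>i. perfect_bsts i) (f B) (g B)))"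
    using not_sublinear_walks_prod[OF keys order_refl] by blast
qed

end
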